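(* Let $(G,\oplus)$ be a normed gyrogroup with gyronorm metric $d$. Then $d$ is invariant under left gyrotranslation: $$d(a\oplus x,a\oplus y)=d(x,y)\qquad\text{for all }a,x,y\in G.$$ Hence, for every $a\in G$, the left gyrotranslation $L_a\colon G\to G$, $L_a(x)=a\oplus x$, is an isometry of $G$ with respect to the gyronorm metric.
   Context: A gyrogroup is a nonempty set $G$ with a binary operation $\oplus$ such that: (G1) there is an element $e\in G$ with $e\oplus a=a$ for all $a\in G$; (G2) for each $a\in G$ there is $b\in G$ with $b\oplus a=e$; (G3) for all $a,b\in G$ there is an automorphism $\mathrm{gyr}[a,b]$ of $(G,\oplus)$ (a bijection $G\to G$ preserving $\oplus$) such that $a\oplus(b\oplus c)=(a\oplus b)\oplus\mathrm{gyr}[a,b]c$ for all $c\in G$; (G4) $\mathrm{gyr}[a\oplus b,b]=\mathrm{gyr}[a,b]$ for all $a,b\in G$. Then $e$ is the unique two-sided identity and each $a$ has a unique two-sided inverse $\ominus a$; $\mathrm{gyr}[a,b]$ is called the gyroautomorphism generated by $a$ and $b$. A gyronorm on a gyrogroup $G$ is a function $\|\cdot\|\colon G\to\mathbb{R}$ such that: (1) $\|x\|\ge 0$ for all $x\in G$, and $\|x\|=0$ if and only if $x=e$; (2) $\|\ominus x\|=\|x\|$ for all $x\in G$; (3) $\|x\oplus y\|\le\|x\|+\|y\|$ for all $x,y\in G$; (4) $\|\mathrm{gyr}[a,b]x\|=\|x\|$ for all $a,b,x\in G$. A normed gyrogroup is a gyrogroup equipped with a gyronorm; its gyronorm metric is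 $d(x,y)=\|\ominus x\oplus y\|$. An isometry of $G$ is a distance-preserving bijection of $(G,d)$ onto itself. *)

theory Defs
  imports Complex_Main
begin

text \<open>
  The underlying set is an explicit carrier \<open>G\<close>; all functions are total on the ambient type and
  are constrained on \<open>G\<close> only. The map \<open>gyr\<close> is a parameter, as its values on \<open>G\<close> are determined by
  the left gyroassociative law and left cancellation.
\<close>

locale gyrogroup =
  fixes G :: "'a set"
    and gplus :: "'a \<Rightarrow> 'a \<Rightarrow> 'a"  (infixl "\<oplus>" 65)
    and gyr :: "'a \<Rightarrow> 'a \<Rightarrow> 'a \<Rightarrow> 'a"
  assumes nonempty: "G \<noteq> {}"
    and closed: "a \<in> G \<Longrightarrow> b \<in> G \<Longrightarrow> a \<oplus> b \<in> G"
    and left_id_left_inv: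
      "\<exists>e\<in>G. (\<forall>a\<in>G. e \<oplus> a = a) \<and> (\<forall>a\<in>G. \<exists>b\<in>G. b \<oplus> a = e)"
    and gyr_bij: "a \<in> G \<Longrightarrow> b \<in> G \<Longrightarrow> bij_betw (gyr a b) G G"
    and gyr_hom: "a \<in> G \<Longrightarrow> b \<in> G \<Longrightarrow> x \<in> G \<Longrightarrow> y \<in> G \<Longrightarrow>
      gyr a b (x \<oplus> y) = gyr a b x \<oplus> gyr a b y"
    and left_gyroassoc: "a \<in> G \<Longrightarrow> b \<in> G \<Longrightarrow> c \<in> G \<Longrightarrow>
      a \<oplus> (b \<oplus> c) = (a \<oplus> b) \<oplus> gyr a b c"
    and left_loop: "a \<in> G \<Longrightarrow> b \<in> G \<Longrightarrow> c \<in> G \<Longrightarrow> gyr (a \<oplus> b) b c = gyr a b c"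

definition gyro_id :: "'a set \<Rightarrow> ('a \<Rightarrow> 'a \<Rightarrow> 'a) \<Rightarrow> 'a" where
  "gyro_id G gplus = (THE e. e \<in> G \<and> (\<forall>a\<in>G. gplus e a = a \<and> gplus a e = a))"

definition gyro_inv :: "'a set \<Rightarrow> ('a \<Rightarrow> 'a \<Rightarrow> 'a) \<Rightarrow> 'a \<Rightarrow> 'a" where
  "gyro_inv G gplus a =
    (THE b. b \<in> G \<and> gplus b a = gyro_id G gplus \<and> gplus a b = gyro_id G gplus)"

text \<open>The descriptions above denote: existence and uniqueness in every gyrogroup.\<close>

context gyrogroup
begin

lemma ex1_identity_and_inverse:
  "\<exists>!e. e \<in> G \<and> (\<forall>a\<in>G. e \<oplus> a = a \<and> a \<oplus> e = a)"
  "\<And>a. a \<in> G \<Longrightarrow> \<exists>!b. b \<in> G \<and> b \<oplus> a = gyro_id G (\<oplus>) \<and> a \<oplus> b = gyro_id G (\<oplus>)"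
proof -
  obtain e where e: "e \<in> G" "\<And>a. a \<in> G \<Longrightarrow> e \<oplus> a = a"
    and inv: "\<And>a. a \<in> G \<Longrightarrow> \<exists>b\<in>G. b \<oplus> a = e"
    using left_id_left_inv by blast
  have gyr_in: "gyr a b c \<in> G" if "a \<in> G" "b \<in> G" "c \<in> G" for a b c
    using gyr_bij[OF that(1,2)] that(3) by (auto simp: bij_betw_def)
  have cancel: "b = c" if "a \<in> G" "b \<in> G" "c \<in> G" "a \<oplus> b = a \<oplus> c" for a b c
  proof -
    obtain a' where a': "a' \<in> G" "a' \<oplus> a = e" using inv[OF \<open>a \<in> G\<close>] by blast
    have "gyr a' a b = gyr a' a c"
      using left_gyroassoc[OF a'(1) that(1) that(2)] left_gyroassoc[OF a'(1) that(1) that(3)]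
      by (simp add: a' that e gyr_in)
    then show ?thesis
      using gyr_bij[OF a'(1) that(1)] that by (auto simp: bij_betw_def inj_on_def)
  qed
  have gyr_e: "gyr e a c = c" if "a \<in> G" "c \<in> G" for a c
  proof -
    have "a \<oplus> gyr e a c = a \<oplus> c"
      using left_gyroassoc[OF e(1) that] by (simp add: e(2) that closed)
    then show ?thesis
      using cancel[OF that(1) gyr_in[OF e(1) that] that(2)] by simp
  qed
  have left_cancel: "a' \<oplus> (a \<oplus> b) = b"
    if "a' \<in> G" "a \<in> G" "b \<in> G" "a' \<oplus> a = e" for a a' b
  proof -
    have "gyr a' a b = b"
      using left_loop[OF that(1-3)] by (simp add: that(4) gyr_e[OF that(2,3)])
    then show ?thesis
      using left_gyroassoc[OF that(1-3)] by (simp add: that(4) e(2)[OF that(3)])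
  qed
  have right_id: "a \<oplus> e = a" if a: "a \<in> G" for a
  proof -
    obtain a' where a': "a' \<in> G" "a' \<oplus> a = e" using inv a by blast
    show ?thesis
      using left_cancel[OF a'(1) a e(1) a'(2)] a' a e(1)
      by - (rule cancel[OF a'(1)], simp_all add: closed)
  qed
  show ex1: "\<exists>!e. e \<in> G \<and> (\<forall>a\<in>G. e \<oplus> a = a \<and> a \<oplus> e = a)"
    using e right_id by metis
  have id_eq: "gyro_id G (\<oplus>) = e"
    unfolding gyro_id_def by (rule the1_equality[OF ex1]) (simp add: e right_id)
  show "\<exists>!b. b \<in> G \<and> b \<oplus> a = gyro_id G (\<oplus>) \<and> a \<oplus> b = gyro_id G (\<oplus>)" if a: "a \<in> G" for a
  proof -
    obtain a' where a': "a' \<in> G" "a' \<oplus> a = e" using inv a by blast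
    have "a \<oplus> a' = e"
      using left_cancel[OF a'(1) a a'(1) a'(2)] a' a e(1) right_id[OF a'(1)]
      by - (rule cancel[OF a'(1)], simp_all add: closed)
    then show ?thesis unfolding id_eq using a' cancel[OF a] by metis
  qed
qed

lemma gyro_id:
  "gyro_id G (\<oplus>) \<in> G"
  "a \<in> G \<Longrightarrow> gyro_id G (\<oplus>) \<oplus> a = a"
  "a \<in> G \<Longrightarrow> a \<oplus> gyro_id G (\<oplus>) = a"
  using theI'[OF ex1_identity_and_inverse(1)] unfolding gyro_id_def by auto

lemma gyro_inv:
  assumes "a \<in> G"
  shows "gyro_inv G (\<oplus>) a \<in> G"
    and "gyro_inv G (\<oplus>) a \<oplus> a = gyro_id G (\<oplus>)"
    and "a \<oplus> gyro_inv G (\<oplus>) a = gyro_id G (\<oplus>)"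
  using theI'[OF ex1_identity_and_inverse(2)[OF assms]] unfolding gyro_inv_def by auto

end

locale normed_gyrogroup = gyrogroup G gplus gyr
  for G :: "'a set"
    and gplus :: "'a \<Rightarrow> 'a \<Rightarrow> 'a"  (infixl "\<oplus>" 65)
    and gyr :: "'a \<Rightarrow> 'a \<Rightarrow> 'a \<Rightarrow> 'a" +
  fixes gnorm :: "'a \<Rightarrow> real"
  assumes gnorm_nonneg: "x \<in> G \<Longrightarrow> 0 \<le> gnorm x"
    and gnorm_eq_0_iff: "x \<in> G \<Longrightarrow> gnorm x = 0 \<longleftrightarrow> x = gyro_id G (\<oplus>)"
    and gnorm_inv: "x \<in> G \<Longrightarrow> gnorm (gyro_inv G (\<oplus>) x) = gnorm x"
    and gnorm_triangle: "x \<in> G \<Longrightarrow> y \<in> G \<Longrightarrow> gnorm (x \<oplus> y) \<le> gnorm x + gnorm y"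
    and gnorm_gyr: "a \<in> G \<Longrightarrow> b \<in> G \<Longrightarrow> x \<in> G \<Longrightarrow> gnorm (gyr a b x) = gnorm x"

definition gyronorm_metric ::
    "'a set \<Rightarrow> ('a \<Rightarrow> 'a \<Rightarrow> 'a) \<Rightarrow> ('a \<Rightarrow> real) \<Rightarrow> 'a \<Rightarrow> 'a \<Rightarrow> real" where
  "gyronorm_metric G gplus gnorm x y = gnorm (gplus (gyro_inv G gplus x) y)"

definition isometry_of :: "'a set \<Rightarrow> ('a \<Rightarrow> 'a \<Rightarrow> real) \<Rightarrow> ('a \<Rightarrow> 'a) \<Rightarrow> bool" where
  "isometry_of M d f \<longleftrightarrow> bij_betw f M M \<and> (\<forall>x\<in>M. \<forall>y\<in>M. d (f x) (f y) = d x y)"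

definition left_gyrotranslation :: "('a \<Rightarrow> 'a \<Rightarrow> 'a) \<Rightarrow> 'a \<Rightarrow> 'a \<Rightarrow> 'a" where
  "left_gyrotranslation gplus a = (\<lambda>x. gplus a x)"

end

(* Write z = \<ominus>x \<oplus> y. By left cancellation y = x \<oplus> z, so left gyroassociativity gives
   a \<oplus> y = (a \<oplus> x) \<oplus> gyr[a,x] z, that is, \<ominus>(a \<oplus> x) \<oplus> (a \<oplus> y) = gyr[a,x] (\<ominus>x \<oplus> y);
   gyroautomorphisms preserve the norm. *)
theory Submission
  imports Defs
begin

context gyrogroup
begin

lemma gyr_closed:
  assumes "a \<in> G" "b \<in> G" "c \<in> G"
  shows "gyr a b c \<in> G"
  using gyr_bij[OF assms(1,2)] assms(3) by (auto simp: bij_betw_def)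

text \<open>Adding the left inverse \<open>?a'\<close> on the left and regrouping turns the two
  sides into \<open>gyr ?a' a b\<close> and \<open>gyr ?a' a c\<close>; gyrations are injective on
  \<open>G\<close>.\<close>

lemma gplus_left_cancel:
  assumes "a \<in> G" "b \<in> G" "c \<in> G" "a \<oplus> b = a \<oplus> c"
  shows "b = c"
proof -
  let ?a' = "gyro_inv G (\<oplus>) a"
  have a': "?a' \<in> G" "?a' \<oplus> a = gyro_id G (\<oplus>)"
    using gyro_inv assms(1) by auto
  have "gyr ?a' a b = gyr ?a' a c"
    using left_gyroassoc[OF a'(1) assms(1,2)] left_gyroassoc[OF a'(1) assms(1,3)]
    by (simp add: a' assms gyro_id gyr_closed)
  then show ?thesis
    using gyr_bij[OF a'(1) assms(1)] assms(2,3) by (auto simp: bij_betw_def inj_on_def)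
qed

text \<open>Gyroassociativity with the identity as first argument reads a \<oplus> c = a \<oplus>
  gyr[e,a] c, where \<open>a\<close> cancels.\<close>

lemma gyr_id_left:
  assumes "a \<in> G" "c \<in> G"
  shows "gyr (gyro_id G (\<oplus>)) a c = c"
proof -
  have "a \<oplus> gyr (gyro_id G (\<oplus>)) a c = a \<oplus> c"
    using left_gyroassoc[OF gyro_id(1) assms] by (simp add: gyro_id(2) assms closed)
  then show ?thesis
    using gplus_left_cancel[OF assms(1) gyr_closed[OF gyro_id(1) assms] assms(2)] by simp
qed

text \<open>The left loop property makes the gyration trivial: gyr[b,a] = gyr[b \<oplus> a, a] =
  gyr[e,a]. Stating this for any pair with b \<oplus> a = e lets an element and its inverse exchange
  roles, since inverses are two-sided.\<close>

lemma gplus_inverse_cancel: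
  assumes "a \<in> G" "b \<in> G" "c \<in> G" "b \<oplus> a = gyro_id G (\<oplus>)"
  shows "b \<oplus> (a \<oplus> c) = c"
proof -
  have "gyr b a c = c"
    using left_loop[OF assms(2,1,3)] by (simp add: assms(4) gyr_id_left[OF assms(1,3)])
  then show ?thesis
    using left_gyroassoc[OF assms(2,1,3)] by (simp add: assms(4) gyro_id(2)[OF assms(3)])
qed

lemma gyro_inv_gplus_cancel:
  assumes "a \<in> G" "c \<in> G"
  shows "gyro_inv G (\<oplus>) a \<oplus> (a \<oplus> c) = c" "a \<oplus> (gyro_inv G (\<oplus>) a \<oplus> c) = c"
  using gplus_inverse_cancel gyro_inv[OF assms(1)] assms by simp_all

lemma gyro_inv_gplus_gplus:
  assumes a: "a \<in> G" and x: "x \<in> G" and y: "y \<in> G"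
  shows "gyro_inv G (\<oplus>) (a \<oplus> x) \<oplus> (a \<oplus> y) = gyr a x (gyro_inv G (\<oplus>) x \<oplus> y)"
proof -
  let ?z = "gyro_inv G (\<oplus>) x \<oplus> y"
  have z: "?z \<in> G"
    by (intro closed gyro_inv(1) x y)
  have "a \<oplus> y = (a \<oplus> x) \<oplus> gyr a x ?z"
    using left_gyroassoc[OF a x z] by (simp add: gyro_inv_gplus_cancel(2)[OF x y])
  then show ?thesis
    by (simp add: gyro_inv_gplus_cancel(1) closed[OF a x] gyr_closed[OF a x z])
qed

lemma bij_betw_left_gyrotranslation:
  assumes "a \<in> G"
  shows "bij_betw (left_gyrotranslation (\<oplus>) a) G G"
  unfolding left_gyrotranslation_def
  \<comment> \<open>The inverse map is left gyrotranslation by \<ominus>a; the two parts of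
    \<open>gyro_inv_gplus_cancel\<close> are the two composition identities.\<close>
  by (rule bij_betw_byWitness[where f' = "\<lambda>x. gyro_inv G (\<oplus>) a \<oplus> x"])
    (auto simp: gyro_inv_gplus_cancel closed gyro_inv(1) assms)

end

lemma (in normed_gyrogroup) gyronorm_metric_gplus_left:
  assumes "a \<in> G" "x \<in> G" "y \<in> G"
  shows "gyronorm_metric G (\<oplus>) gnorm (a \<oplus> x) (a \<oplus> y) = gyronorm_metric G (\<oplus>) gnorm x y"
  unfolding gyronorm_metric_def gyro_inv_gplus_gplus[OF assms]
  by (intro gnorm_gyr closed gyro_inv(1) assms)

theorem theorem4p1:
  fixes G :: "'a set"
    and gplus :: "'a \<Rightarrow> 'a \<Rightarrow> 'a"  (infixl "\<oplus>" 65)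
    and gyr :: "'a \<Rightarrow> 'a \<Rightarrow> 'a \<Rightarrow> 'a"
    and gnorm :: "'a \<Rightarrow> real"
  assumes "normed_gyrogroup G (\<oplus>) gyr gnorm"
  shows "(\<forall>a\<in>G. \<forall>x\<in>G. \<forall>y\<in>G.
      gyronorm_metric G (\<oplus>) gnorm (a \<oplus> x) (a \<oplus> y) = gyronorm_metric G (\<oplus>) gnorm x y) \<and>
    (\<forall>a\<in>G. isometry_of G (gyronorm_metric G (\<oplus>) gnorm) (left_gyrotranslation (\<oplus>) a))"
proof -
  interpret normed_gyrogroup G "(\<oplus>)" gyr gnorm
    by (rule assms)
  show ?thesis
    using bij_betw_left_gyrotranslation gyronorm_metric_gplus_left
    by (simp add: isometry_of_def left_gyrotranslation_def)
qed

end
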